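(* The following implication is false in general: "if a regular language $L$ with $n$ left quotients has $2^n$ atoms and each of its atoms has maximal quotient complexity, then $L$ has syntactic complexity $n^n$." Specifically, let $\mathcal{D}$ be the DFA with state set $Q=\{0,1,2\}$, alphabet $\{a,b\}$, initial state $0$, set of final states $\{2\}$, and transitions $a:\ 0\mapsto 1,\ 1\mapsto 2,\ 2\mapsto 0$ and $b:\ 0\mapsto 1,\ 1\mapsto 0,\ 2\mapsto 0$. Then $\mathcal{D}$ is minimal, the language $L$ accepted by $\mathcal{D}$ has all $2^3=8$ atoms, each of which has maximal quotient complexity (for $n=3$), but the syntactic complexity of $L$ is $24$, while the maximum is $3^3=27$.
   Context: The left quotient of a language $L\subseteq\Sigma^*$ by a word $w$ is $w^{-1}L=\{x\in\Sigma^*\mid wx\in L\}$. The quotient complexity of a regular language is its number of distinct left quotients (equivalently, the number of states of its minimal complete DFA). The syntactic semigroup of $L$ is $\Sigma^+/\!\approx_L$, where $x\approx_L y$ iff for all $u,v\in\Sigma^*$: $uxv\in L\Leftrightarrow uyv\in L$. It is isomorphic to the semigroup of transformations of the state set of the minimal DFA of $L$ induced by non-empty words. The syntactic complexity of $L$ is the cardinality of this semigroup; for a language with $n$ quotients it is at most $n^n$. Let $K_0,\dots,K_{n-1}$ be the distinct left quotients of $L$ and $Q=\{0,\dots,n-1\}$. For $S\subseteq Q$ define $A_S=\left(\bigcap_{i\in S}K_i\right)\cap\left(\bigcap_{j\in Q\setminus S}\overline{K_j}\right)$, where $\overline{K_j}=\Sigma^*\setminus K_j$. An atom of $L$ is a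 non-empty language of the form $A_S$. An atom $A_S$ with $r=|Q\setminus S|$ complemented quotients has maximal quotient complexity if its number of distinct left quotients equals $2^n-1$ when $r\in\{0,n\}$, and equals $1+\sum_{k=1}^{r}\sum_{h=k+1}^{k+n-r}\binom{n}{h}\binom{h}{k}$ when $1\le r\le n-1$. (For $n=3$ these values are $7,10,10,7$ for $r=0,1,2,3$.) *)

theory Defs
  imports Complex_Main "HOL-Library.Numeral_Type"
begin

(* Languages over the alphabet 'a are sets of type 'a list set, so that the set of all words
   is UNIV and complements of languages are set complements. *)

definition left_quotient :: "'a list \<Rightarrow> 'a list set \<Rightarrow> 'a list set" where
  "left_quotient w L = {x. w @ x \<in> L}"

definition quotients :: "'a list set \<Rightarrow> 'a list set set" where
  "quotients L = range (\<lambda>w. left_quotient w L)"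

(* card is 0 on infinite sets, so this and syntactic_complexity are meaningful for
   regular languages only. *)
definition quotient_complexity :: "'a list set \<Rightarrow> nat" where
  "quotient_complexity L = card (quotients L)"

(* Complete DFAs. Every finite automaton can be renamed to have natural numbers as states, so
   fixing the type of states loses nothing when quantifying over automata.
   The transition function is unconstrained outside the state set. *)
record 'a dfa =
  states :: "nat set"
  trans_fun :: "nat \<Rightarrow> 'a \<Rightarrow> nat"
  initial :: nat
  finals :: "nat set"

definition wf_dfa :: "'a dfa \<Rightarrow> bool" where
  "wf_dfa D \<longleftrightarrow> finite (states D) \<and> initial D \<in> states D \<and> finals D \<subseteq> states D \<and>
     (\<forall>q\<in>states D. \<forall>x. trans_fun D q x \<in> states D)"

definition dfa_language :: "'a dfa \<Rightarrow> 'a list set" where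
  "dfa_language D = {w. foldl (trans_fun D) (initial D) w \<in> finals D}"

definition minimal_dfa :: "'a dfa \<Rightarrow> bool" where
  "minimal_dfa D \<longleftrightarrow> wf_dfa D \<and>
     (\<forall>D'. wf_dfa D' \<and> dfa_language D' = dfa_language D \<longrightarrow> card (states D) \<le> card (states D'))"

definition regular :: "'a list set \<Rightarrow> bool" where
  "regular L \<longleftrightarrow> (\<exists>D. wf_dfa D \<and> dfa_language D = L)"

definition syntactic_cong :: "'a list set \<Rightarrow> ('a list \<times> 'a list) set" where
  "syntactic_cong L =
     {(x, y). x \<noteq> [] \<and> y \<noteq> [] \<and> (\<forall>u v. u @ x @ v \<in> L \<longleftrightarrow> u @ y @ v \<in> L)}"

lemma equiv_syntactic_cong: "equiv {w. w \<noteq> []} (syntactic_cong L)"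
  unfolding syntactic_cong_def equiv_def refl_on_def sym_def trans_def by auto

lemma syntactic_cong_append:
  assumes "(x, y) \<in> syntactic_cong L" and "(x', y') \<in> syntactic_cong L"
  shows "(x @ x', y @ y') \<in> syntactic_cong L"
proof -
  have "u @ x @ (x' @ v) \<in> L \<longleftrightarrow> u @ y @ (x' @ v) \<in> L" for u v
    using assms(1) unfolding syntactic_cong_def by blast
  moreover have "(u @ y) @ x' @ v \<in> L \<longleftrightarrow> (u @ y) @ y' @ v \<in> L" for u v
    using assms(2) unfolding syntactic_cong_def by blast
  ultimately show ?thesis
    using assms unfolding syntactic_cong_def by simp
qed

definition syntactic_semigroup :: "'a list set \<Rightarrow> 'a list set set" where
  "syntactic_semigroup L = {w. w \<noteq> []} // syntactic_cong L"

definition syntactic_complexity :: "'a list set \<Rightarrow> nat" where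
  "syntactic_complexity L = card (syntactic_semigroup L)"

(* The set S of indices of quotients is represented by the set of the quotients themselves.
   Intersections over the empty family are UNIV. *)
definition atomic_intersection :: "'a list set \<Rightarrow> 'a list set set \<Rightarrow> 'a list set" where
  "atomic_intersection L S = (\<Inter>K\<in>S. K) \<inter> (\<Inter>K\<in>quotients L - S. - K)"

definition atoms :: "'a list set \<Rightarrow> 'a list set set" where
  "atoms L = {atomic_intersection L S | S. S \<subseteq> quotients L \<and> atomic_intersection L S \<noteq> {}}"

definition max_atom_complexity :: "nat \<Rightarrow> nat \<Rightarrow> nat" where
  "max_atom_complexity n r =
     (if r = 0 \<or> r = n then 2 ^ n - 1
      else 1 + (\<Sum>k = 1..r. \<Sum>h = k + 1..k + n - r. (n choose h) * (h choose k)))"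

lemma max_atom_complexity_3:
  "max_atom_complexity 3 0 = 7" "max_atom_complexity 3 1 = 10"
  "max_atom_complexity 3 2 = 10" "max_atom_complexity 3 3 = 7"
  by (simp_all add: max_atom_complexity_def numeral_eq_Suc)

definition all_atoms_maximal :: "'a list set \<Rightarrow> bool" where
  "all_atoms_maximal L \<longleftrightarrow>
     (\<forall>S. S \<subseteq> quotients L \<and> atomic_intersection L S \<noteq> {} \<longrightarrow>
        quotient_complexity (atomic_intersection L S)
          = max_atom_complexity (quotient_complexity L) (card (quotients L - S)))"

datatype letter = letter_a | letter_b

lemma UNIV_letter: "(UNIV :: letter set) = {letter_a, letter_b}"
  using letter.exhaust by auto

instance letter :: finite
  by standard (subst UNIV_letter, rule finite.insertI, rule finite.insertI, rule finite.emptyI)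

definition example_dfa :: "letter dfa" where
  "example_dfa = \<lparr>
     states = {0, 1, 2},
     trans_fun = (\<lambda>q x. case x of
         letter_a \<Rightarrow> (if q = 0 then 1 else if q = 1 then 2 else 0)
       | letter_b \<Rightarrow> (if q = 0 then 1 else 0)),
     initial = 0,
     finals = {2}\<rparr>"

end

(* A word x determines the set P of states that x sends to a final state.  If every subset of the
   states of a minimal DFA arises as such a P, then the atoms are the classes of words with a fixed
   P = S, and the quotient of the atom of S by w consists of the words x whose set P satisfies
   t -` P = S, where t is the transformation induced by w.  Hence the quotient complexity of the
   atom of S is the number of families {P. t -` P = S}, with t ranging over the transition monoid,
   and everything about the example is read off from that monoid.  It consists of all
   transformations of {0, 1, 2} except the three transpositions. *)
theory Submission
  imports Defs "HOL-Library.FuncSet"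
begin

section \<open>Runs of automata and quotients of their languages\<close>

definition run :: "'a dfa \<Rightarrow> nat \<Rightarrow> 'a list \<Rightarrow> nat" where
  "run D = foldl (trans_fun D)"

lemma run_simps [simp]:
  "run D q [] = q"
  "run D q (x # w) = run D (trans_fun D q x) w"
  "run D q (u @ w) = run D (run D q u) w"
  by (simp_all add: run_def)

definition state_language :: "'a dfa \<Rightarrow> nat \<Rightarrow> 'a list set" where
  "state_language D q = {w. run D q w \<in> finals D}"

lemma dfa_language_eq: "dfa_language D = state_language D (initial D)"
  by (simp add: dfa_language_def state_language_def run_def)

lemma left_quotient_state_language:
  "left_quotient w (state_language D q) = state_language D (run D q w)"
  by (simp add: left_quotient_def state_language_def)

lemma quotients_dfa_language:
  "quotients (dfa_language D) = state_language D ` range (run D (initial D))"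
  by (simp add: quotients_def dfa_language_eq left_quotient_state_language image_image)

lemma run_in_states:
  "wf_dfa D \<Longrightarrow> q \<in> states D \<Longrightarrow> run D q w \<in> states D"
  by (induction w arbitrary: q) (auto simp: wf_dfa_def)

text \<open>Each quotient is the language of a reachable state. This is the lower bound behind
  minimality.\<close>

lemma quotient_complexity_le_states:
  assumes "wf_dfa D"
  shows "quotient_complexity (dfa_language D) \<le> card (states D)"
proof -
  have "range (run D (initial D)) \<subseteq> states D"
    using assms run_in_states[OF assms] by (auto simp: wf_dfa_def)
  moreover have "finite (states D)"
    using assms by (simp add: wf_dfa_def)
  ultimately show ?thesis
    unfolding quotient_complexity_def quotients_dfa_language
    by (meson card_image_le card_mono finite_subset le_trans)
qed

section \<open>Syntactic complexity as the number of induced maps\<close>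

text \<open>The classes are the non-empty fibres of \<open>f\<close> inside \<open>A\<close>, and
  such a fibre determines its value.\<close>

lemma card_quotient_kernel:
  "card (A // {(x, y). x \<in> A \<and> y \<in> A \<and> f x = f y}) = card (f ` A)"
proof -
  have "A // {(x, y). x \<in> A \<and> y \<in> A \<and> f x = f y} = (\<lambda>c. {y \<in> A. f y = c}) ` f ` A"
  proof -
    have "{(x, y). x \<in> A \<and> y \<in> A \<and> f x = f y} `` {a} = {y \<in> A. f y = f a}"
      if "a \<in> A" for a
      using that by auto
    then show ?thesis
      unfolding quotient_def image_image by auto
  qed
  moreover have "inj_on (\<lambda>c. {y \<in> A. f y = c}) (f ` A)"
    by (rule inj_onI) blast
  ultimately show ?thesis
    by (simp add: card_image)
qed

lemma syntactic_complexity_kernel: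
  assumes "\<And>x y. f x = f y \<longleftrightarrow> (\<forall>u v. u @ x @ v \<in> L \<longleftrightarrow> u @ y @ v \<in> L)"
  shows "syntactic_complexity L = card (f ` {w. w \<noteq> []})"
proof -
  have "syntactic_cong L = {(x, y). x \<in> {w. w \<noteq> []} \<and> y \<in> {w. w \<noteq> []} \<and> f x = f y}"
    by (auto simp: syntactic_cong_def assms)
  then show ?thesis
    unfolding syntactic_complexity_def syntactic_semigroup_def
    by (simp only: card_quotient_kernel)
qed

text \<open>Words act on the quotients by taking left quotients, and the syntactic congruence is the
  kernel of this action, so its classes inject into the self-maps of the set of quotients.\<close>

lemma syntactic_complexity_le:
  fixes L :: "'a list set"
  assumes "finite (quotients L)"
  shows "syntactic_complexity L \<le> quotient_complexity L ^ quotient_complexity L"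
proof -
  let ?K = "quotients L"
  \<comment> \<open>\<open>restrict\<close> makes equality of actions compare values on quotients
    only and places them in the finite space \<open>?K \<rightarrow>\<^sub>E ?K\<close>.\<close>
  define act where "act w = restrict (left_quotient w) ?K" for w :: "'a list"
  have "act x = act y \<longleftrightarrow> (\<forall>u v. u @ x @ v \<in> L \<longleftrightarrow> u @ y @ v \<in> L)"
    for x y :: "'a list"
  proof -
    have "act x = act y \<longleftrightarrow> (\<forall>K\<in>?K. left_quotient x K = left_quotient y K)"
      unfolding act_def by (auto simp: fun_eq_iff)
    \<comment> \<open>The quotient by \<open>u\<close> supplies the left context, a member
      \<open>v\<close> of the further quotient the right one.\<close>
    also have "\<dots> \<longleftrightarrow> (\<forall>u v. u @ x @ v \<in> L \<longleftrightarrow> u @ y @ v \<in> L)"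
      by (auto simp: quotients_def left_quotient_def set_eq_iff)
    finally show ?thesis .
  qed
  then have "syntactic_complexity L = card (act ` {w. w \<noteq> []})"
    by (rule syntactic_complexity_kernel)
  also have "\<dots> \<le> card (?K \<rightarrow>\<^sub>E ?K)"
  proof (rule card_mono)
    show "finite (?K \<rightarrow>\<^sub>E ?K)"
      using assms by (simp add: finite_PiE)
    have "left_quotient w (left_quotient u L) = left_quotient (u @ w) L" for u w
      by (simp add: left_quotient_def)
    then show "act ` {w. w \<noteq> []} \<subseteq> ?K \<rightarrow>\<^sub>E ?K"
      by (auto simp: act_def quotients_def)
  qed
  also have "\<dots> = card ?K ^ card ?K"
    using assms by (rule card_funcsetE)
  finally show ?thesis
    by (simp add: quotient_complexity_def)
qed

section \<open>Reduced automata and their transition semigroups\<close>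

text \<open>The states come as a list so that a transformation can be written as the list of its
  images and evaluated.\<close>

locale reduced_dfa =
  fixes D :: "'a dfa" and qs :: "nat list"
  assumes wf: "wf_dfa D"
    and states: "states D = set qs"
    and reachable: "\<And>q. q \<in> set qs \<Longrightarrow> \<exists>w. run D (initial D) w = q"
    and distinguishable: "inj_on (state_language D) (set qs)"
begin

lemma run_in_qs: "q \<in> set qs \<Longrightarrow> run D q w \<in> set qs"
  using run_in_states[OF wf] states by simp

lemma range_run_initial: "range (run D (initial D)) = set qs"
proof
  show "range (run D (initial D)) \<subseteq> set qs"
    using wf run_in_qs by (auto simp: wf_dfa_def states)
  show "set qs \<subseteq> range (run D (initial D))"
    using reachable by blast
qed

lemma quotients_eq: "quotients (dfa_language D) = state_language D ` set qs"
  by (simp add: quotients_dfa_language range_run_initial)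

lemma quotient_complexity_eq: "quotient_complexity (dfa_language D) = card (set qs)"
  by (simp add: quotient_complexity_def quotients_eq card_image distinguishable)

lemma minimal: "minimal_dfa D"
  unfolding minimal_dfa_def states quotient_complexity_eq[symmetric]
  using wf quotient_complexity_le_states by metis

definition act :: "'a list \<Rightarrow> nat list" where
  "act w = map (\<lambda>q. run D q w) qs"

text \<open>Left contexts reach exactly the states, by reachability; right contexts then compare
  state languages, which determine the states.\<close>

lemma syntactic_complexity_eq:
  "syntactic_complexity (dfa_language D) = card (act ` {w. w \<noteq> []})"
proof (rule syntactic_complexity_kernel)
  fix x y
  have "(\<forall>u v. u @ x @ v \<in> dfa_language D \<longleftrightarrow> u @ y @ v \<in> dfa_language D) \<longleftrightarrow>
      (\<forall>q\<in>range (run D (initial D)).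
        state_language D (run D q x) = state_language D (run D q y))"
    by (auto simp: dfa_language_eq state_language_def)
  also have "\<dots> \<longleftrightarrow> (\<forall>q\<in>set qs. run D q x = run D q y)"
    unfolding range_run_initial
    by (rule ball_cong) (simp_all add: inj_on_eq_iff[OF distinguishable] run_in_qs)
  finally show "act x = act y \<longleftrightarrow>
      (\<forall>u v. u @ x @ v \<in> dfa_language D \<longleftrightarrow> u @ y @ v \<in> dfa_language D)"
    by (simp add: act_def)
qed

text \<open>\<open>T\<close> contains the identity and is closed under appending a letter, so it
  contains every \<open>act w\<close>; the witnesses in \<open>W\<close> give the converse. Since
  these are non-empty, even the identity is induced by a non-empty word, and the transition
  semigroup equals the transition monoid.\<close>

lemma act_image:
  assumes "qs \<in> T" and "\<And>t x. t \<in> T \<Longrightarrow> map (\<lambda>q. trans_fun D q x) t \<in> T"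
    and "T \<subseteq> act ` W" and "[] \<notin> W"
  shows "act ` {w. w \<noteq> []} = T" and "range act = T"
proof -
  have "act w \<in> T" for w
  proof (induction w rule: rev_induct)
    case Nil
    show ?case using assms(1) by (simp add: act_def)
  next
    case (snoc x w)
    then show ?case using assms(2)[of "act w" x] by (simp add: act_def comp_def)
  qed
  moreover have "T \<subseteq> act ` {w. w \<noteq> []}"
    using assms(3,4) by blast
  ultimately show "act ` {w. w \<noteq> []} = T" "range act = T"
    by auto
qed

section \<open>Atoms of a reduced automaton and their quotients\<close>

definition accepting_states :: "'a list \<Rightarrow> nat set" where
  "accepting_states x = {q \<in> set qs. run D q x \<in> finals D}"

lemma atomic_intersection_eq:
  assumes "S \<subseteq> set qs"
  shows "atomic_intersection (dfa_language D) (state_language D ` S)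
    = {x. accepting_states x = S}"
proof -
  have "quotients (dfa_language D) - state_language D ` S = state_language D ` (set qs - S)"
    unfolding quotients_eq using assms distinguishable by (simp add: inj_on_image_set_diff)
  then show ?thesis
    using assms unfolding atomic_intersection_def
    by (auto simp: accepting_states_def state_language_def)
qed

text \<open>Prefixing \<open>x\<close> by \<open>w\<close> replaces
  \<open>accepting_states x\<close> by its preimage under the transformation of
  \<open>w\<close>.\<close>

lemma left_quotient_atom:
  "left_quotient w {x. accepting_states x = S} =
    {x. accepting_states x \<in> {P \<in> Pow (set qs). {q \<in> set qs. run D q w \<in> P} = S}}"
  by (auto simp: left_quotient_def accepting_states_def run_in_qs)

context
  assumes all_subsets: "Pow (set qs) \<subseteq> range accepting_states"
begin

text \<open>Every subset is realised by some word, so a family can be recovered from its words.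
  Quotients of atoms can therefore be counted as families of subsets, which is a finite
  computation.\<close>

lemma words_of_subsets_inj:
  assumes "G \<subseteq> Pow (set qs)" "H \<subseteq> Pow (set qs)"
    and "{x. accepting_states x \<in> G} = {x. accepting_states x \<in> H}"
  shows "G = H"
proof -
  have "P \<in> G \<longleftrightarrow> P \<in> H" if P: "P \<subseteq> set qs" for P
  proof -
    obtain x where "accepting_states x = P"
      using all_subsets P by blast
    then show ?thesis
      using assms(3) by blast
  qed
  then show ?thesis
    using assms(1,2) by blast
qed

lemma card_atoms: "card (atoms (dfa_language D)) = 2 ^ card (set qs)"
proof -
  have nonempty: "{x. accepting_states x = S} \<noteq> {}" if "S \<subseteq> set qs" for S
    using all_subsets that by blast
  have "atoms (dfa_language D) = (\<lambda>S. {x. accepting_states x = S}) ` Pow (set qs)"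
  proof
    show "atoms (dfa_language D) \<subseteq> (\<lambda>S. {x. accepting_states x = S}) ` Pow (set qs)"
    proof
      fix A assume "A \<in> atoms (dfa_language D)"
      then obtain S where "S \<subseteq> set qs"
        and "A = atomic_intersection (dfa_language D) (state_language D ` S)"
        unfolding atoms_def quotients_eq by (auto simp: subset_image_iff)
      then show "A \<in> (\<lambda>S. {x. accepting_states x = S}) ` Pow (set qs)"
        by (simp add: atomic_intersection_eq)
    qed
    show "(\<lambda>S. {x. accepting_states x = S}) ` Pow (set qs) \<subseteq> atoms (dfa_language D)"
    proof clarify
      fix S assume "S \<subseteq> set qs"
      then show "{x. accepting_states x = S} \<in> atoms (dfa_language D)"
        using atomic_intersection_eq[of S] nonempty[of S]
        unfolding atoms_def quotients_eq by (blast intro: image_mono)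
    qed
  qed
  moreover have "inj_on (\<lambda>S. {x. accepting_states x = S}) (Pow (set qs))"
    using nonempty by (intro inj_onI) blast
  ultimately show ?thesis
    by (simp add: card_image card_Pow)
qed

lemma quotient_complexity_atom:
  "quotient_complexity {x. accepting_states x = S} =
    card (range (\<lambda>w. {P \<in> Pow (set qs). {q \<in> set qs. run D q w \<in> P} = S}))"
proof -
  have "quotients {x. accepting_states x = S} = (\<lambda>G. {x. accepting_states x \<in> G}) `
      range (\<lambda>w. {P \<in> Pow (set qs). {q \<in> set qs. run D q w \<in> P} = S})"
    unfolding quotients_def left_quotient_atom image_image ..
  moreover have "inj_on (\<lambda>G. {x. accepting_states x \<in> G})
      (range (\<lambda>w. {P \<in> Pow (set qs). {q \<in> set qs. run D q w \<in> P} = S}))"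
    by (intro inj_onI words_of_subsets_inj) auto
  ultimately show ?thesis
    by (simp add: quotient_complexity_def card_image)
qed

lemma all_atoms_maximalI:
  assumes "\<And>S. S \<subseteq> set qs \<Longrightarrow>
    card (range (\<lambda>w. {P \<in> Pow (set qs). {q \<in> set qs. run D q w \<in> P} = S}))
      = max_atom_complexity (card (set qs)) (card (set qs - S))"
  shows "all_atoms_maximal (dfa_language D)"
proof -
  have "quotient_complexity (atomic_intersection (dfa_language D) (state_language D ` S))
      = max_atom_complexity (card (set qs))
          (card (quotients (dfa_language D) - state_language D ` S))" if "S \<subseteq> set qs" for S
  proof -
    have "quotients (dfa_language D) - state_language D ` S = state_language D ` (set qs - S)"
      unfolding quotients_eq using that distinguishable by (simp add: inj_on_image_set_diff)
    moreover have "card (state_language D ` (set qs - S)) = card (set qs - S)"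
      using distinguishable by (meson Diff_subset card_image inj_on_subset)
    ultimately show ?thesis
      using assms[OF that] by (simp add: atomic_intersection_eq[OF that] quotient_complexity_atom)
  qed
  then show ?thesis
    by (auto simp: all_atoms_maximal_def quotients_eq subset_image_iff quotient_complexity_eq)
qed

end

end

section \<open>The example automaton with 24 transformations\<close>

text \<open>Witnesses for the entries of \<open>example_transformations\<close>, in the same order;
  \<open>[a,a,a]\<close> induces the identity.\<close>

definition example_words :: "letter list list" where
  "example_words = (let a = letter_a; b = letter_b in
     [[a], [b], [a,a], [a,b], [b,a], [b,b], [a,a,a], [a,a,b], [a,b,a], [a,b,b], [b,a,a], [b,a,b],
      [b,b,a], [a,a,b,a], [a,a,b,b], [a,b,a,a], [a,b,b,a], [b,a,b,a], [b,b,a,a], [a,a,b,a,a],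
      [a,a,b,b,a], [a,b,b,a,a], [b,a,b,a,a], [a,a,b,b,a,a]])"

text \<open>As \<open>b\<close> is not injective, the only permutations here are the powers of the
  3-cycle \<open>a\<close>; this is why the transpositions are missing.\<close>

definition example_transformations :: "nat list list" where
  "example_transformations =
     [[1,2,0], [1,0,0], [2,0,1], [0,0,1], [2,1,1], [0,1,1], [0,1,2], [0,1,0], [1,1,2],
      [1,1,0], [0,2,2], [0,0,0], [1,2,2], [1,2,1], [1,0,1], [2,2,0], [2,2,1], [1,1,1],
      [2,0,0], [2,0,2], [2,1,2], [0,0,2], [2,2,2], [0,2,0]]"

lemma example_simps [simp]:
  "states example_dfa = {0, 1, 2}" "initial example_dfa = 0" "finals example_dfa = {2}"
  "trans_fun example_dfa q letter_a = (if q = 0 then 1 else if q = 1 then 2 else 0)"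
  "trans_fun example_dfa q letter_b = (if q = 0 then 1 else 0)"
  by (simp_all add: example_dfa_def)

interpretation example: reduced_dfa example_dfa "[0, 1, 2]"
proof
  show "wf_dfa example_dfa"
    by (simp add: wf_dfa_def example_dfa_def split: letter.split)
  show "states example_dfa = set [0, 1, 2]"
    by simp
  show "\<exists>w. run example_dfa (initial example_dfa) w = q" if "q \<in> set [0, 1, 2]" for q
  proof -
    have "run example_dfa 0 [] = 0" "run example_dfa 0 [letter_a] = 1"
      "run example_dfa 0 [letter_a, letter_a] = 2"
      by simp_all
    then show ?thesis
      using that unfolding example_simps by (metis empty_iff insert_iff list.set)
  qed
  \<comment> \<open>The empty word separates 2 from the other states, and the letter a separates 1
    from 0.\<close>
  have "[] \<in> state_language example_dfa 2" "[] \<notin> state_language example_dfa 1"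
    "[] \<notin> state_language example_dfa 0" "[letter_a] \<in> state_language example_dfa 1"
    "[letter_a] \<notin> state_language example_dfa 0"
    by (simp_all add: state_language_def)
  then show "inj_on (state_language example_dfa) (set [0, 1, 2])"
    by (auto simp: inj_on_def)
qed

lemma example_act_words: "map example.act example_words = example_transformations"
  unfolding example_words_def Let_def example_transformations_def example.act_def by simp

lemma example_act_image:
  "example.act ` {w. w \<noteq> []} = set example_transformations"
  "range example.act = set example_transformations"
proof -
  have id: "[0, 1, 2] \<in> set example_transformations"
    by (simp add: example_transformations_def)
  have step: "map (\<lambda>q. trans_fun example_dfa q x) t \<in> set example_transformations"
    if "t \<in> set example_transformations" for t x
    using that by (cases x) (auto simp: example_transformations_def)
  have words: "set example_transformations \<subseteq> example.act ` set example_words"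
    by (simp add: example_act_words[symmetric])
  have nil: "[] \<notin> set example_words"
    by (simp add: example_words_def)
  show "example.act ` {w. w \<noteq> []} = set example_transformations"
    "range example.act = set example_transformations"
    using example.act_image[OF id step words nil] by blast+
qed

lemma example_all_subsets: "Pow (set [0, 1, 2]) \<subseteq> range example.accepting_states"
proof -
  \<comment> \<open>States coincide with list positions, so \<open>example.act w ! q\<close> is the
    image of \<open>q\<close>; \<open>Set.filter\<close> makes the set executable for
    \<open>code_simp\<close>.\<close>
  have "example.accepting_states w
      = Set.filter (\<lambda>q. example.act w ! q = 2) (set [0, 1, 2])" for w
    unfolding example.accepting_states_def example.act_def by auto
  then have "range example.accepting_states =
      (\<lambda>t. Set.filter (\<lambda>q. t ! q = 2) (set [0, 1, 2])) ` set example_transformations"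
    unfolding example_act_image(2)[symmetric] image_image by simp
  also have "Pow (set [0, 1, 2]) \<subseteq> \<dots>"
    by code_simp
  finally show ?thesis .
qed

text \<open>An exhaustive evaluation over the 8 subsets and 24 transformations; 7 and 10 are the
  values of \<open>max_atom_complexity 3\<close>.\<close>

lemma example_atom_quotients:
  "\<forall>S\<in>Pow (set [0, 1, 2]).
    card ((\<lambda>t. Set.filter (\<lambda>P. Set.filter (\<lambda>q. t ! q \<in> P) (set [0, 1, 2]) = S)
        (Pow (set [0, 1, 2]))) ` set example_transformations)
      = (if card (set [0, 1, 2] - S) \<in> {0, 3} then 7 else 10)"
  by code_simp

lemma example_all_atoms_maximal: "all_atoms_maximal (dfa_language example_dfa)"
proof (rule example.all_atoms_maximalI[OF example_all_subsets])
  fix S :: "nat set" assume S: "S \<subseteq> set [0, 1, 2]"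
  let ?F = "\<lambda>t. Set.filter (\<lambda>P. Set.filter (\<lambda>q. t ! q \<in> P) (set [0, 1, 2]) = S)
    (Pow (set [0, 1, 2]))"
  have "{P \<in> Pow (set [0, 1, 2]). {q \<in> set [0, 1, 2]. run example_dfa q w \<in> P} = S}
      = ?F (example.act w)" for w
  proof -
    have "Set.filter (\<lambda>q. example.act w ! q \<in> P) (set [0, 1, 2]) =
      {q \<in> set [0, 1, 2]. run example_dfa q w \<in> P}" for P
      unfolding example.act_def by auto
    then show ?thesis
      by auto
  qed
  then have "range (\<lambda>w. {P \<in> Pow (set [0, 1, 2]).
      {q \<in> set [0, 1, 2]. run example_dfa q w \<in> P} = S}) = ?F ` set example_transformations"
    unfolding example_act_image(2)[symmetric] image_image by simp
  then have "card (range (\<lambda>w. {P \<in> Pow (set [0, 1, 2]).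
      {q \<in> set [0, 1, 2]. run example_dfa q w \<in> P} = S}))
      = (if card (set [0, 1, 2] - S) \<in> {0, 3} then 7 else 10)"
    using bspec[OF example_atom_quotients, of S] S by simp
  moreover have card_states: "card (set [0, 1, 2 :: nat]) = 3"
    by simp
  \<comment> \<open>Exactly the arguments covered by \<open>max_atom_complexity_3\<close>.\<close>
  moreover have "card (set [0, 1, 2] - S) \<in> {0, 1, 2, 3}"
    using card_mono[of "set [0, 1, 2]" "set [0, 1, 2] - S"] by fastforce
  ultimately show "card (range (\<lambda>w. {P \<in> Pow (set [0, 1, 2]).
      {q \<in> set [0, 1, 2]. run example_dfa q w \<in> P} = S}))
      = max_atom_complexity (card (set [0, 1, 2 :: nat])) (card (set [0, 1, 2] - S))"
    unfolding card_states using max_atom_complexity_3 by (auto simp del: One_nat_def)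
qed

lemma example_syntactic_complexity: "syntactic_complexity (dfa_language example_dfa) = 24"
  unfolding example.syntactic_complexity_eq example_act_image(1) by code_simp

section \<open>Sharpness of the bound 27 for three quotients\<close>

text \<open>A cycle, a transposition and a transformation of rank two generate all transformations of
  three states.\<close>

definition full_dfa :: "3 dfa" where
  "full_dfa = \<lparr>
     states = {0, 1, 2},
     trans_fun = (\<lambda>q x.
       if x = 0 then (if q = 0 then 1 else if q = 1 then 2 else 0)
       else if x = 1 then (if q = 0 then 1 else if q = 1 then 0 else q)
       else (if q = 2 then 0 else q)),
     initial = 0,
     finals = {2}\<rparr>"

text \<open>One non-empty word for each of the 27 transformations; \<open>[1,1]\<close> induces the
  identity.\<close>

definition full_words :: "3 list list" where
  "full_words =
     [[0], [1], [2], [0,0], [0,1], [0,2], [1,0], [1,1], [2,0], [2,1], [0,0,2], [0,2,0], [0,2,1],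
      [2,0,0], [2,0,1], [2,1,0], [0,0,2,0], [0,0,2,1], [0,2,0,0], [0,2,0,1], [0,2,1,0], [2,0,0,2],
      [0,0,2,0,0], [0,0,2,0,1], [0,0,2,1,0], [2,0,0,2,0], [2,0,0,2,0,0]]"

lemma full_simps [simp]:
  "states full_dfa = {0, 1, 2}" "initial full_dfa = 0" "finals full_dfa = {2}"
  "trans_fun full_dfa q 0 = (if q = 0 then 1 else if q = 1 then 2 else 0)"
  "trans_fun full_dfa q 1 = (if q = 0 then 1 else if q = 1 then 0 else q)"
  "trans_fun full_dfa q 2 = (if q = 2 then 0 else q)"
  by (simp_all add: full_dfa_def)

interpretation full: reduced_dfa full_dfa "[0, 1, 2]"
proof
  show "wf_dfa full_dfa"
    by (simp add: wf_dfa_def full_dfa_def)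
  show "states full_dfa = set [0, 1, 2]"
    by simp
  show "\<exists>w. run full_dfa (initial full_dfa) w = q" if "q \<in> set [0, 1, 2]" for q
  proof -
    have "run full_dfa 0 [] = 0" "run full_dfa 0 [0] = 1" "run full_dfa 0 [0, 0] = 2"
      by simp_all
    then show ?thesis
      using that unfolding full_simps by (metis empty_iff insert_iff list.set)
  qed
  have "[] \<in> state_language full_dfa 2" "[] \<notin> state_language full_dfa 1"
    "[] \<notin> state_language full_dfa 0" "[0] \<in> state_language full_dfa 1"
    "[0] \<notin> state_language full_dfa 0"
    by (simp_all add: state_language_def)
  then show "inj_on (state_language full_dfa) (set [0, 1, 2])"
    by (auto simp: inj_on_def)
qed

lemma full_act_words:
  "map full.act full_words =
     [[1,2,0], [1,0,2], [0,1,0], [2,0,1], [0,2,1], [1,0,0], [2,1,0], [0,1,2], [1,2,1],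
      [1,0,1], [0,0,1], [2,1,1], [0,1,1], [2,0,2], [0,2,0], [2,1,2], [1,1,2], [1,1,0],
      [0,2,2], [2,0,0], [1,2,2], [0,0,0], [2,2,0], [0,0,2], [2,2,1], [1,1,1], [2,2,2]]"
  unfolding full_words_def full.act_def by simp

text \<open>\<open>List.n_lists 3 [0, 1, 2]\<close> enumerates all self-maps of the state set as
  lists of images.\<close>

lemma full_act_words_set: "set (map full.act full_words) = set (List.n_lists 3 [0, 1, 2])"
  unfolding full_act_words by code_simp

lemma full_syntactic_complexity: "syntactic_complexity (dfa_language full_dfa) = 27"
proof -
  let ?T = "set (List.n_lists 3 [0, 1, 2 :: nat])"
  have id: "[0, 1, 2] \<in> ?T"
    by (simp add: set_n_lists)
  \<comment> \<open>A transition is a run on a one-letter word and so preserves the state set; no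
    case distinction is needed.\<close>
  have step: "map (\<lambda>q. trans_fun full_dfa q x) t \<in> ?T" if "t \<in> ?T" for t x
    using that full.run_in_qs[of _ "[x]"] unfolding set_n_lists run_simps
    by (simp only: mem_Collect_eq length_map list.set_map) blast
  have words: "?T \<subseteq> full.act ` set full_words"
    by (simp only: full_act_words_set[symmetric] set_map subset_refl)
  have nil: "[] \<notin> set full_words"
    by (simp add: full_words_def)
  have "full.act ` {w. w \<noteq> []} = ?T"
    using full.act_image(1)[OF id step words nil] .
  then have "syntactic_complexity (dfa_language full_dfa) = card ?T"
    unfolding full.syntactic_complexity_eq by simp
  also have "\<dots> = 27"
    by code_simp
  finally show ?thesis .
qed

text \<open>The last two conjuncts express that 27 is the maximum. The witness has three letters
  because the symmetric group on three states is not cyclic: two permutations and a non-injective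
  map are required.\<close>

theorem mainTheorem2:
  shows "\<not> (\<forall>(L :: letter list set) n.
            regular L \<and> quotient_complexity L = n \<and> card (atoms L) = 2 ^ n \<and> all_atoms_maximal L
            \<longrightarrow> syntactic_complexity L = n ^ n)
    \<and> minimal_dfa example_dfa
    \<and> quotient_complexity (dfa_language example_dfa) = 3
    \<and> card (atoms (dfa_language example_dfa)) = 2 ^ 3
    \<and> all_atoms_maximal (dfa_language example_dfa)
    \<and> syntactic_complexity (dfa_language example_dfa) = 24
    \<and> (\<forall>L :: 'b::finite list set.
          regular L \<and> quotient_complexity L = 3 \<longrightarrow> syntactic_complexity L \<le> 3 ^ 3)
    \<and> (\<exists>L :: 3 list set.
          regular L \<and> quotient_complexity L = 3 \<and> syntactic_complexity L = 3 ^ 3)"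
proof -
  let ?L = "dfa_language example_dfa"
  have reg: "regular ?L"
    using example.wf by (auto simp: regular_def)
  have complexity: "quotient_complexity ?L = 3"
    by (simp add: example.quotient_complexity_eq)
  have atoms: "card (atoms ?L) = 2 ^ 3"
    using example.card_atoms[OF example_all_subsets] by simp
  have "\<not> (\<forall>(L :: letter list set) n.
      regular L \<and> quotient_complexity L = n \<and> card (atoms L) = 2 ^ n \<and> all_atoms_maximal L
      \<longrightarrow> syntactic_complexity L = n ^ n)"
  proof
    assume "\<forall>(L :: letter list set) n.
      regular L \<and> quotient_complexity L = n \<and> card (atoms L) = 2 ^ n \<and> all_atoms_maximal L
      \<longrightarrow> syntactic_complexity L = n ^ n"
    then have "syntactic_complexity ?L = 3 ^ 3"
      using reg complexity atoms example_all_atoms_maximal by blast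
    then show False
      using example_syntactic_complexity by simp
  qed
  moreover have "syntactic_complexity L \<le> 3 ^ 3"
    if "quotient_complexity L = 3" for L :: "'b list set"
  proof -
    \<comment> \<open>Infinite sets have \<open>card\<close> 0, so the value 3 gives
      finiteness.\<close>
    have "finite (quotients L)"
      using that by (intro card_ge_0_finite) (simp add: quotient_complexity_def)
    then show ?thesis
      using syntactic_complexity_le[of L] that by simp
  qed
  moreover have "regular (dfa_language full_dfa)"
    using full.wf by (auto simp: regular_def)
  moreover have "quotient_complexity (dfa_language full_dfa) = 3"
    by (simp add: full.quotient_complexity_eq)
  moreover have "syntactic_complexity (dfa_language full_dfa) = 3 ^ 3"
    by (simp add: full_syntactic_complexity)
  ultimately show ?thesis
    using example.minimal complexity atoms example_all_atoms_maximal example_syntactic_complexity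
    by blast
qed

end
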